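(* Except for $O_7$ and trees of order $5$, every tree $T$ has a $6^*$-coloring such that every color class is an all-$5$-isolating set of $T$.
   Context: Graphs are finite and simple; the order of a graph is its number of vertices. For a graph $G$ and $S\subseteq V(G)$, $N[S]$ denotes $S$ together with all vertices adjacent to a vertex of $S$. A set $S\subseteq V(G)$ (possibly empty) is an all-$k$-isolating set of $G$ if $G-N[S]$ has no component of order at least $k$. An $\ell^*$-coloring of a graph is a weak partition of its vertex set into $\ell$ independent sets (the color classes), where color classes are allowed to be empty; that is, a proper coloring with colors $1,\dots,\ell$, not all of which need be used. $O_7$ is the tree of order $7$ obtained from the star $K_{1,3}$ by subdividing each edge once. *)

theory Defs
  imports
    "Graph_Theory.Pair_Digraph"
    "Graph_Theory.Digraph_Component"
    "Graph_Theory.Digraph_Isomorphism"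
begin

text \<open>
  A finite simple graph is a \<^locale>\<open>pair_graph\<close>: a finite, loop-free, symmetric digraph whose
  arcs are ordered pairs, so that an edge uv is the pair of arcs (u,v), (v,u).

  The library predicate \<^const>\<open>tree\<close> cannot be used for such graphs: the closed walk u,v,u along a
  single edge counts as a \<^const>\<open>pre_digraph.cycle\<close>. Cycles of the undirected graph are exactly
  those of length at least 3.
\<close>

definition undirected_tree :: "'a pair_pre_digraph \<Rightarrow> bool" where
  "undirected_tree G \<longleftrightarrow>
     pair_graph G \<and> connected (with_proj G) \<and>
     \<not> (\<exists>p. pre_digraph.cycle (with_proj G) p \<and> 3 \<le> length p)"

definition closed_nbhd :: "'a pair_pre_digraph \<Rightarrow> 'a set \<Rightarrow> 'a set" where
  "closed_nbhd G S = S \<union> {v \<in> pverts G. \<exists>u\<in>S. (u, v) \<in> parcs G}"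

text \<open>
  The components of a symmetric digraph are its strongly connected components
  \<^const>\<open>pre_digraph.sccs\<close>, which are nonempty induced subgraphs.
\<close>

definition all_isolating :: "nat \<Rightarrow> 'a pair_pre_digraph \<Rightarrow> 'a set \<Rightarrow> bool" where
  "all_isolating k G S \<longleftrightarrow>
     S \<subseteq> pverts G \<and>
     \<not> (\<exists>H \<in> pre_digraph.sccs (with_proj G \<restriction> (pverts G - closed_nbhd G S)). k \<le> card (verts H))"

definition color_class :: "'a pair_pre_digraph \<Rightarrow> ('a \<Rightarrow> nat) \<Rightarrow> nat \<Rightarrow> 'a set" where
  "color_class G c i = {v \<in> pverts G. c v = i}"

text \<open>
  The color classes are those of all of the colors 1, ..., l, so a class may be empty.
\<close>

definition star_coloring :: "nat \<Rightarrow> 'a pair_pre_digraph \<Rightarrow> ('a \<Rightarrow> nat) \<Rightarrow> bool" where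
  "star_coloring l G c \<longleftrightarrow>
     (\<forall>v\<in>pverts G. c v \<in> {1..l}) \<and> (\<forall>(u, v)\<in>parcs G. c u \<noteq> c v)"

definition star_K13 :: "nat pair_pre_digraph" where
  "star_K13 = \<lparr> pverts = {0, 1, 2, 3}, parcs = {0} \<times> {1, 2, 3} \<union> {1, 2, 3} \<times> {0} \<rparr>"

definition O7 :: "nat pair_pre_digraph" where
  "O7 = subdivide (subdivide (subdivide star_K13 (0, 1) 4) (0, 2) 5) (0, 3) 6"

lemma pverts_O7: "pverts O7 = {0, 1, 2, 3, 4, 5, 6}"
  by (auto simp: O7_def star_K13_def subdivide.simps)

lemma parcs_O7:
  "parcs O7 =
     {(0, 4), (4, 0), (0, 5), (5, 0), (0, 6), (6, 0),
      (4, 1), (1, 4), (5, 2), (2, 5), (6, 3), (3, 6)}"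
  by (auto simp: O7_def star_K13_def subdivide.simps)

end

theory Submission
  imports Defs
begin

text \<open>
  A color class is all-5-isolating iff it meets the closed neighbourhood of every connected vertex
  set of order at least 5. So the task is to find a proper coloring with the colors 1 to 6 in which
  every connected \<open>A\<close> of order at least 5 sees all six colors, that is, has them all in
  \<open>N[A]\<close>. On at most four vertices there is no such \<open>A\<close> and any injective coloring works.

  Root the tree. Each connected set has a top vertex, so it suffices to control the connected sets
  with top \<open>x\<close> for each \<open>x\<close> in turn. The induction works with the branch below \<open>x\<close> together with
  the parent \<open>p\<close> of \<open>x\<close>, and its claim (\<open>gradable_3\<close>) is that for every order
  \<open>s\<^sub>0, \<dots>, s\<^sub>5\<close> of the six colors the branch has a coloring with \<open>p\<close> and \<open>x\<close> colored \<open>s\<^sub>0\<close>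
  and \<open>s\<^sub>1\<close> in which a connected set of order \<open>a\<close> with top \<open>x\<close> sees \<open>s\<^sub>0, \<dots>, s\<^sub>a\<close>, and
  sees \<open>s\<^bsub>a+1\<^esub>\<close> as well if it is not the whole branch and \<open>a + 1 \<le> 3\<close>. Prescribing the order is
  what makes the colorings of the child branches combine: a connected set with top \<open>x\<close> splits into
  \<open>x\<close> and connected sets in the child branches, and the orders for the children can be matched so
  that every way of distributing the vertices over the children shows the next color. One child
  inherits the order of \<open>x\<close>, shifted by one place; more children show more colors by themselves
  and only leave one or two colors to be arranged. The bonus color \<open>s\<^bsub>a+1\<^esub>\<close> settles the
  distributions in which two child branches receive two vertices each.

  If some vertex has degree at least 3, make it the root. It has no parent to contribute a color,
  but its children show at least three colors, and the same matching of orders works unless there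
  are exactly three child branches of order 2, which is \<open>O\<^sub>7\<close>, or fewer than six vertices
  (\<open>full_or_spider\<close>). Otherwise the tree is a path. Rooted at an end, every branch is a path too,
  and there the bonus color is available without the restriction \<open>a + 1 \<le> 3\<close>
  (\<open>gradable_chain\<close>); this makes up for the missing parent of the root (\<open>full_path\<close>).
\<close>

section \<open>Rooted trees\<close>

text \<open>
  The parent map encodes the edges, and any function that decreases along it, such as the
  distance to the root, makes it well-founded. The value of the parent map at the root is arbitrary.
\<close>

locale rooted_tree =
  fixes V :: "'a set" and r :: 'a and par :: "'a \<Rightarrow> 'a" and dep :: "'a \<Rightarrow> nat"
  assumes finite_V: "finite V"
    and root_in_V: "r \<in> V"
    and par_in_V: "v \<in> V \<Longrightarrow> v \<noteq> r \<Longrightarrow> par v \<in> V"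
    and dep_par: "v \<in> V \<Longrightarrow> v \<noteq> r \<Longrightarrow> dep (par v) < dep v"
begin

definition up :: "'a rel" where
  "up = {(v, par v) |v. v \<in> V \<and> v \<noteq> r}"

definition branch :: "'a \<Rightarrow> 'a set" where
  "branch x = {v. (v, x) \<in> up\<^sup>*}"

definition children :: "'a \<Rightarrow> 'a set" where
  "children x = {y \<in> V. y \<noteq> r \<and> par y = x}"

text \<open>
  The connected sets with top vertex \<open>x\<close>.
\<close>

definition subtree_at :: "'a \<Rightarrow> 'a set \<Rightarrow> bool" where
  "subtree_at x A \<longleftrightarrow> x \<in> A \<and> A \<subseteq> branch x \<and> (\<forall>v\<in>A - {x}. par v \<in> A)"

text \<open>The closed neighbourhood of a connected set, except for the parent of its top vertex.\<close>

definition down :: "'a set \<Rightarrow> 'a set" where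
  "down A = A \<union> {v \<in> V. v \<noteq> r \<and> par v \<in> A}"

lemma up_iff: "(v, w) \<in> up \<longleftrightarrow> v \<in> V \<and> v \<noteq> r \<and> w = par v"
  by (auto simp: up_def)

lemma finite_children: "finite (children x)"
  using finite_V by (simp add: children_def)

lemma branch_self: "x \<in> branch x"
  by (simp add: branch_def)

lemma branch_subset: assumes "x \<in> V" shows "branch x \<subseteq> V"
proof
  fix v assume "v \<in> branch x"
  then have "(v, x) \<in> up\<^sup>*" by (simp add: branch_def)
  then show "v \<in> V" using assms by (cases rule: converse_rtranclE) (auto simp: up_iff)
qed

lemma finite_branch: "x \<in> V \<Longrightarrow> finite (branch x)"
  using branch_subset finite_V finite_subset by blast

lemma dep_branch: "v \<in> branch x \<Longrightarrow> v = x \<or> dep x < dep v"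
proof -
  assume "v \<in> branch x"
  then have "(v, x) \<in> up\<^sup>*" by (simp add: branch_def)
  then show ?thesis
    by (induction rule: converse_rtrancl_induct) (auto simp: up_iff dest: dep_par)
qed

lemma branch_unfold: "branch x = insert x (\<Union>y\<in>children x. branch y)"
proof (intro equalityI subsetI)
  fix v assume "v \<in> branch x"
  then have "(v, x) \<in> up\<^sup>*" by (simp add: branch_def)
  then show "v \<in> insert x (\<Union>y\<in>children x. branch y)"
    by (cases rule: rtranclE) (auto simp: up_iff children_def branch_def)
next
  fix v assume "v \<in> insert x (\<Union>y\<in>children x. branch y)"
  then show "v \<in> branch x"
    by (auto simp: up_iff children_def branch_def intro: rtrancl_into_rtrancl)
qed

lemma child_branch_subset: "y \<in> children x \<Longrightarrow> branch y \<subseteq> branch x"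
  using branch_unfold[of x] by auto

lemma not_in_child_branch: "y \<in> children x \<Longrightarrow> x \<notin> branch y"
  using dep_branch[of x y] dep_par[of y] by (auto simp: children_def)

lemma child_branches_disjoint:
  assumes "y \<in> children x" "z \<in> children x" "y \<noteq> z"
  shows "branch y \<inter> branch z = {}"
proof (rule ccontr)
  assume "branch y \<inter> branch z \<noteq> {}"
  then obtain v where "(v, y) \<in> up\<^sup>*" "(v, z) \<in> up\<^sup>*" by (auto simp: branch_def)
  moreover have "single_valued up" by (auto simp: single_valued_def up_iff)
  ultimately have "(y, z) \<in> up\<^sup>* \<or> (z, y) \<in> up\<^sup>*" using single_valued_confluent by metis
  moreover have "(x, w) \<in> up\<^sup>*" if "(u, w) \<in> up\<^sup>*" "u \<noteq> w" "u \<in> children x" for u w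
    using that by (cases rule: converse_rtranclE) (auto simp: up_iff children_def)
  ultimately have "(x, z) \<in> up\<^sup>* \<or> (x, y) \<in> up\<^sup>*"
    using assms by blast
  then show False using assms not_in_child_branch by (auto simp: branch_def)
qed

lemma child_of_branch:
  assumes "v \<in> branch x" "v \<noteq> x"
  obtains y where "y \<in> children x" "v \<in> branch y"
  using assms branch_unfold[of x] by auto

lemma par_in_branch: "v \<in> branch x \<Longrightarrow> v \<noteq> x \<Longrightarrow> par v \<in> branch x"
  by (auto simp: branch_def up_iff elim: converse_rtranclE)

lemma branch_root: "branch r = V"
proof (intro equalityI subsetI)
  fix v assume "v \<in> V"
  then show "v \<in> branch r"
  proof (induction "dep v" arbitrary: v rule: less_induct)
    case less
    show ?case
    proof (cases "v = r")
      case False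
      then have "(v, par v) \<in> up" "(par v, r) \<in> up\<^sup>*"
        using less dep_par[of v] par_in_V[of v] by (auto simp: up_iff branch_def)
      then show ?thesis by (auto simp: branch_def intro: converse_rtrancl_into_rtrancl)
    qed (simp add: branch_self)
  qed
qed (use branch_subset root_in_V in blast)

lemma down_subset:
  assumes "A \<subseteq> branch x" shows "down A \<subseteq> branch x"
proof
  fix v assume "v \<in> down A"
  then consider "v \<in> A" | "(v, par v) \<in> up" "par v \<in> branch x"
    using assms by (auto simp: down_def up_iff)
  then show "v \<in> branch x"
    using assms by cases (auto simp: branch_def intro: converse_rtrancl_into_rtrancl)
qed

lemma down_mono: "A \<subseteq> B \<Longrightarrow> down A \<subseteq> down B"
  by (auto simp: down_def)

text \<open>
  Splits a set with top \<open>x\<close> along the child branches. Used both for connected sets and for the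
  branch itself, so that the two cardinalities can be compared child by child.
\<close>

lemma card_below:
  assumes "x \<in> V" "x \<in> A" "A \<subseteq> branch x"
  shows "card A = Suc (\<Sum>y\<in>children x. card (A \<inter> branch y))"
proof -
  have fin: "finite (A \<inter> branch y)" if "y \<in> children x" for y
    using that finite_branch[of y] by (auto simp: children_def)
  have "A = insert x (\<Union>y\<in>children x. A \<inter> branch y)"
    using assms branch_unfold[of x] by blast
  also have "card \<dots> = Suc (card (\<Union>y\<in>children x. A \<inter> branch y))"
    using not_in_child_branch fin finite_children by (intro card_insert_disjoint finite_UN_I) auto
  also have "card (\<Union>y\<in>children x. A \<inter> branch y) = (\<Sum>y\<in>children x. card (A \<inter> branch y))"
    using child_branches_disjoint fin finite_children by (intro card_UN_disjoint) blast+
  finally show ?thesis .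
qed

lemma card_branch: "x \<in> V \<Longrightarrow> card (branch x) = Suc (\<Sum>y\<in>children x. card (branch y))"
  using card_below[of x "branch x"] child_branch_subset[of _ x]
  by (simp add: branch_self Int_absorb1)

text \<open>
  A vertex of \<open>A\<close> below the child \<open>y\<close> can only be connected to \<open>x\<close> inside \<open>A\<close> through \<open>y\<close>.
\<close>

lemma subtree_at_child:
  assumes A: "subtree_at x A" and y: "y \<in> children x" and ne: "A \<inter> branch y \<noteq> {}"
  shows "subtree_at y (A \<inter> branch y)"
proof -
  obtain v where "v \<in> A" "(v, y) \<in> up\<^sup>*" using ne by (auto simp: branch_def)
  from this(2,1) have "y \<in> A"
  proof (induction rule: converse_rtrancl_induct)
    case (step v w)
    then have "v \<in> branch y" by (auto simp: branch_def intro: converse_rtrancl_into_rtrancl)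
    then have "v \<noteq> x" using y not_in_child_branch by blast
    then show ?case using step A by (auto simp: subtree_at_def up_iff)
  qed simp
  then show ?thesis
    using A not_in_child_branch[OF y] par_in_branch[of _ y]
    by (auto simp: subtree_at_def branch_self)
qed

section \<open>Colorings of a branch\<close>

text \<open>
  The requirements on a coloring that do not involve the parent of \<open>x\<close>. The connected sets with
  top strictly below \<open>x\<close> belong here, because the parent of their top is a vertex of the branch.
\<close>

definition valid_below :: "'a \<Rightarrow> ('a \<Rightarrow> nat) \<Rightarrow> bool" where
  "valid_below x c \<longleftrightarrow>
     (\<forall>v\<in>branch x. c v \<in> {1..6}) \<and> (\<forall>v\<in>branch x - {x}. c v \<noteq> c (par v)) \<and>
     (\<forall>t\<in>branch x - {x}. \<forall>A. subtree_at t A \<longrightarrow> 5 \<le> card A \<longrightarrow>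
        {1..6} \<subseteq> insert (c (par t)) (c ` down A))"

text \<open>
  Position \<open>i\<close> in the order of colors is promised to a connected set of order \<open>a\<close> in a branch of
  order \<open>n\<close>. The second alternative is the bonus color: a set that is not the whole branch has a
  further vertex in its neighbourhood. The bound \<open>K\<close> limits it, because below a branching vertex the
  promise cannot always be kept for large \<open>i\<close>.
\<close>

definition reach :: "nat \<Rightarrow> nat \<Rightarrow> nat \<Rightarrow> nat \<Rightarrow> bool" where
  "reach K n a i \<longleftrightarrow> i \<le> a \<or> (a < n \<and> i \<le> Suc a \<and> i \<le> K)"

text \<open>
  The color at position 0 stands for that of the parent of \<open>x\<close>. The parent lies outside the branch,
  so this color counts as seen whatever \<open>c\<close> is there.
\<close>

definition graded :: "nat \<Rightarrow> 'a \<Rightarrow> nat list \<Rightarrow> ('a \<Rightarrow> nat) \<Rightarrow> bool" where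
  "graded K x ps c \<longleftrightarrow> valid_below x c \<and> c x = ps ! 1 \<and>
     (\<forall>A i. subtree_at x A \<longrightarrow> i < length ps \<longrightarrow> reach K (card (branch x)) (card A) i \<longrightarrow>
        ps ! i \<in> insert (ps ! 0) (c ` down A))"

definition ordering :: "nat list \<Rightarrow> bool" where
  "ordering ps \<longleftrightarrow> distinct ps \<and> set ps = {1..6}"

definition gradable :: "nat \<Rightarrow> 'a \<Rightarrow> bool" where
  "gradable K x \<longleftrightarrow> (\<forall>ps. ordering ps \<longrightarrow> (\<exists>c. graded K x ps c))"

lemma ordering_length: "ordering ps \<Longrightarrow> length ps = 6"
  unfolding ordering_def using distinct_card[of ps] by simp

lemma ordering_extend:
  assumes "distinct ps" "set ps \<subseteq> {1..6}"
  obtains qs where "ordering (ps @ qs)"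
proof -
  obtain qs where "set qs = {1..6} - set ps" "distinct qs"
    using finite_distinct_list[of "{1..6} - set ps"] by auto
  with assms show ?thesis by (intro that[of qs]) (auto simp: ordering_def)
qed

text \<open>
  Being graded depends only on the colors inside the branch, because downward neighbourhoods do not
  leave it. This is what allows colorings of disjoint branches to be merged.
\<close>

lemma graded_cong:
  assumes "\<And>v. v \<in> branch x \<Longrightarrow> c v = d v" "graded K x ps c"
  shows "graded K x ps d"
proof -
  have img: "c ` down A = d ` down A" if "subtree_at t A" "t \<in> branch x" for t A
  proof -
    have "branch t \<subseteq> branch x"
      using that by (auto simp: branch_def intro: rtrancl_trans)
    then have "down A \<subseteq> branch x" using that down_subset[of A x] by (auto simp: subtree_at_def)
    then show ?thesis using assms(1) by (intro image_cong) auto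
  qed
  have par: "c (par v) = d (par v)" if "v \<in> branch x" "v \<noteq> x" for v
    using that par_in_branch assms(1) by blast
  have "valid_below x d"
    unfolding valid_below_def
  proof (intro conjI ballI allI impI)
    fix t A assume *: "t \<in> branch x - {x}" "subtree_at t A" "5 \<le> card A"
    then have "{1..6} \<subseteq> insert (c (par t)) (c ` down A)"
      using assms(2) unfolding graded_def valid_below_def by blast
    then show "{1..6} \<subseteq> insert (d (par t)) (d ` down A)"
      using * img[of t A] par[of t] by auto
  next
    fix v assume "v \<in> branch x" then show "d v \<in> {1..6}"
      using assms unfolding graded_def valid_below_def by force
  next
    fix v assume v: "v \<in> branch x - {x}"
    then have "c v \<noteq> c (par v)"
      using assms(2) unfolding graded_def valid_below_def by blast
    then show "d v \<noteq> d (par v)"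
      using v assms(1)[of v] par[of v] by simp
  qed
  then show ?thesis
    using assms branch_self[of x] img[of x] unfolding graded_def by metis
qed

text \<open>
  The children's branches are disjoint, and the only vertex outside its branch whose color matters
  to a child is \<open>x\<close>. Hence colorings graded for arbitrary orders that begin with the color \<open>k\<close> of \<open>x\<close> merge into one
  coloring. A beginning \<open>ps y\<close> of the order for the child \<open>y\<close> extends to an order of all six
  colors. What remains to be checked at \<open>x\<close> concerns only the numbers
  of vertices that a connected set with top \<open>x\<close> has in the child branches.
\<close>

lemma glue_child_colorings:
  assumes x: "x \<in> V" and k: "k \<in> {1..6}"
    and gr: "\<And>y. y \<in> children x \<Longrightarrow> gradable K y"
    and ps: "\<And>y. y \<in> children x \<Longrightarrow> distinct (ps y) \<and> set (ps y) \<subseteq> {1..6} \<and>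
       2 \<le> length (ps y) \<and> ps y ! 0 = k"
  obtains c where "valid_below x c" "c x = k"
    "\<And>A. subtree_at x A \<Longrightarrow> k \<in> c ` down A"
    "\<And>A y. subtree_at x A \<Longrightarrow> y \<in> children x \<Longrightarrow> ps y ! 1 \<in> c ` down A"
    "\<And>A y i. subtree_at x A \<Longrightarrow> y \<in> children x \<Longrightarrow> 0 < card (A \<inter> branch y) \<Longrightarrow>
       i < length (ps y) \<Longrightarrow> reach K (card (branch y)) (card (A \<inter> branch y)) i \<Longrightarrow>
       ps y ! i \<in> c ` down A"
proof -
  have "\<exists>qs c. ordering (ps y @ qs) \<and> graded K y (ps y @ qs) c" if y: "y \<in> children x" for y
    using ordering_extend[of "ps y"] ps[OF y] gr[OF y] unfolding gradable_def by metis
  then obtain qs cs where qs: "\<And>y. y \<in> children x \<Longrightarrow> ordering (ps y @ qs y)"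
    and cs: "\<And>y. y \<in> children x \<Longrightarrow> graded K y (ps y @ qs y) (cs y)"
    by metis
  define c where "c v = (if v = x then k else cs (THE y. y \<in> children x \<and> v \<in> branch y) v)" for v
  have c_eq: "cs y v = c v" if "y \<in> children x" "v \<in> branch y" for y v
  proof -
    have "(THE y. y \<in> children x \<and> v \<in> branch y) = y"
      using that child_branches_disjoint by blast
    then show ?thesis using that not_in_child_branch by (auto simp: c_def)
  qed
  have cx: "c x = k" by (simp add: c_def)
  have gc: "graded K y (ps y @ qs y) c" if y: "y \<in> children x" for y
    using graded_cong[OF _ cs[OF y]] c_eq[OF y] by blast
  have cy: "c y = ps y ! 1" "(ps y @ qs y) ! 0 = k" if y: "y \<in> children x" for y
  proof -
    have "1 < length (ps y)" "0 < length (ps y)" using ps[OF y] by auto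
    then show "c y = ps y ! 1" "(ps y @ qs y) ! 0 = k"
      using gc[OF y] ps[OF y] by (simp_all add: graded_def nth_append)
  qed
  have kA: "k \<in> c ` down A" if "subtree_at x A" for A
    using that cx by (auto simp: subtree_at_def down_def)
  have par_child: "par y = x" if "y \<in> children x" for y
    using that by (simp add: children_def)
  have "valid_below x c"
    unfolding valid_below_def
  proof (intro conjI ballI allI impI)
    fix v assume "v \<in> branch x"
    then show "c v \<in> {1..6}"
    proof (cases "v = x")
      case False
      then obtain y where "y \<in> children x" "v \<in> branch y"
        using \<open>v \<in> branch x\<close> child_of_branch by blast
      then show ?thesis using gc[of y] by (auto simp: graded_def valid_below_def)
    qed (use k cx in simp)
  next
    fix v assume "v \<in> branch x - {x}"
    then obtain y where y: "y \<in> children x" "v \<in> branch y"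
      using child_of_branch by blast
    show "c v \<noteq> c (par v)"
    proof (cases "v = y")
      case True
      have "ps y ! 1 \<noteq> ps y ! 0"
        using ps[OF y(1)] by (subst nth_eq_iff_index_eq) auto
      then show ?thesis using True y cy cx par_child ps[OF y(1)] by simp
    next
      case False
      then show ?thesis using y gc[of y] by (auto simp: graded_def valid_below_def)
    qed
  next
    fix t A assume t: "t \<in> branch x - {x}" and A: "subtree_at t A" "5 \<le> card A"
    then obtain y where y: "y \<in> children x" "t \<in> branch y"
      using child_of_branch by blast
    (* For the child itself, order at least 5 means that all six positions are promised. *)
    show "{1..6} \<subseteq> insert (c (par t)) (c ` down A)"
    proof (cases "t = y")
      case True
      show ?thesis
      proof
        fix a :: nat assume "a \<in> {1..6}"
        then obtain i where i: "i < 6" "(ps y @ qs y) ! i = a"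
          using qs[OF y(1)] ordering_length[OF qs[OF y(1)]]
          by (metis in_set_conv_nth ordering_def)
        then have "reach K (card (branch y)) (card A) i" using A by (auto simp: reach_def)
        then show "a \<in> insert (c (par t)) (c ` down A)"
          using gc[OF y(1)] A True i ordering_length[OF qs[OF y(1)]] cy[OF y(1)] cx
            par_child[OF y(1)]
          unfolding graded_def by metis
      qed
    next
      case False
      then show ?thesis using y gc[of y] A unfolding graded_def valid_below_def by blast
    qed
  qed
  moreover have "ps y ! 1 \<in> c ` down A" if "subtree_at x A" "y \<in> children x" for A y
  proof -
    have "y \<in> down A" using that by (auto simp: subtree_at_def down_def children_def)
    then show ?thesis using cy that by force
  qed
  moreover have "ps y ! i \<in> c ` down A"
    if A: "subtree_at x A" and y: "y \<in> children x" and pos: "0 < card (A \<inter> branch y)"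
      and i: "i < length (ps y)" "reach K (card (branch y)) (card (A \<inter> branch y)) i" for A y i
  proof -
    have "subtree_at y (A \<inter> branch y)"
      using subtree_at_child[OF A y] pos by fastforce
    then have "(ps y @ qs y) ! i \<in> insert k (c ` down (A \<inter> branch y))"
      using gc[OF y] i cy[OF y] unfolding graded_def by (metis length_append trans_less_add1)
    moreover have "down (A \<inter> branch y) \<subseteq> down A" by (rule down_mono) simp
    ultimately show ?thesis using kA[OF A] i by (auto simp: nth_append)
  qed
  ultimately show ?thesis using that cx kA by blast
qed

lemma gradable_leaf: 
  assumes "x \<in> V" "children x = {}" shows "gradable K x"
  unfolding gradable_def
proof (intro allI impI)
  fix ps assume ps: "ordering ps"
  note [simp] = ordering_length[OF ps]
  have br: "branch x = {x}" using branch_unfold[of x] assms(2) by simp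
  have mem: "ps ! 1 \<in> {1..6}" using ps nth_mem[of 1 ps] by (auto simp: ordering_def)
  have "graded K x ps (\<lambda>_. ps ! 1)"
    unfolding graded_def valid_below_def br
  proof (intro conjI allI impI)
    fix A i assume "subtree_at x A" "i < length ps" "reach K (card {x}) (card A) i"
    moreover from this have "A = {x}" using br by (auto simp: subtree_at_def)
    ultimately have "A = {x}" "i = 0 \<or> i = 1" by (auto simp: reach_def)
    then show "ps ! i \<in> insert (ps ! 0) ((\<lambda>_. ps ! 1) ` down A)" by (auto simp: down_def)
  qed (use mem in auto)
  then show "\<exists>c. graded K x ps c" by blast
qed

lemma list_of_ordering:
  assumes "ordering ps"
  obtains a b c d e f where "ps = [a, b, c, d, e, f]" "distinct [a, b, c, d, e, f]"
    "{a, b, c, d, e, f} \<subseteq> {1..6}"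
proof -
  have "length ps = Suc (Suc (Suc (Suc (Suc (Suc 0)))))" using ordering_length[OF assms] by simp
  then obtain a b c d e f where "ps = [a, b, c, d, e, f]" by (auto simp: length_Suc_conv)
  moreover have "distinct ps" "set ps \<subseteq> {1..6}" using assms by (auto simp: ordering_def)
  ultimately show ?thesis by (intro that) simp_all
qed

lemma gradedI:
  assumes "valid_below x c" "c x = t1"
    and "\<And>A. subtree_at x A \<Longrightarrow>
      (\<forall>i<6. reach K (card (branch x)) (card A) i \<longrightarrow> [t0, t1, t2, t3, t4, t5] ! i \<in> insert t0 (c ` down A))"
  shows "graded K x [t0, t1, t2, t3, t4, t5] c"
  using assms by (simp add: graded_def)

lemma all_less_6: "(\<forall>i<6. P i) \<longleftrightarrow> P 0 \<and> P 1 \<and> P 2 \<and> P 3 \<and> P 4 \<and> P (5::nat)"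
  by (simp add: numeral_eq_Suc All_less_Suc2)

lemma card_part_le: "y \<in> children x \<Longrightarrow> card (A \<inter> branch y) \<le> card (branch y)"
  using finite_branch[of y] by (intro card_mono) (auto simp: children_def)

text \<open>
  The child receives the order of \<open>x\<close> shifted by one place. Removing \<open>x\<close> lowers the order of a
  connected set by one, which the shift compensates; this preserves the bonus color for every \<open>K\<close>.
\<close>

lemma gradable_one_child:
  assumes x: "x \<in> V" and ch: "children x = {y}" and y: "gradable K y"
  shows "gradable K x"
  unfolding gradable_def
proof (intro allI impI)
  fix ps assume "ordering ps"
  then obtain t0 t1 t2 t3 t4 t5 where ps: "ps = [t0, t1, t2, t3, t4, t5]"
    and t: "distinct [t0, t1, t2, t3, t4, t5]" "{t0, t1, t2, t3, t4, t5} \<subseteq> {1..6}"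
    by (rule list_of_ordering)
  obtain c where c: "valid_below x c" "c x = t1" and
    seen: "\<And>A. subtree_at x A \<Longrightarrow> t1 \<in> c ` down A" "\<And>A. subtree_at x A \<Longrightarrow> t2 \<in> c ` down A"
    "\<And>A i. subtree_at x A \<Longrightarrow> 0 < card (A \<inter> branch y) \<Longrightarrow>
       i < 6 \<Longrightarrow> reach K (card (branch y)) (card (A \<inter> branch y)) i \<Longrightarrow>
       [t1, t2, t3, t4, t5, t0] ! i \<in> c ` down A"
    by (rule glue_child_colorings[of x t1 K "\<lambda>_. [t1, t2, t3, t4, t5, t0]"]) (use x y t ch in auto)
  have "graded K x ps c"
    unfolding ps
  proof (rule gradedI[OF c])
    fix A assume A: "subtree_at x A"
    let ?a = "card (A \<inter> branch y)" and ?n = "card (branch y)"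
    have card: "card A = Suc ?a" "card (branch x) = Suc ?n"
      using card_below[OF x, of A] card_branch[OF x] ch A by (auto simp: subtree_at_def)
    have le: "?a \<le> ?n" using card_part_le ch by blast
    show "\<forall>i<6. reach K (card (branch x)) (card A) i \<longrightarrow>
        [t0, t1, t2, t3, t4, t5] ! i \<in> insert t0 (c ` down A)"
    proof (cases "?a = 0")
      case True
      then show ?thesis
        using seen(1,2)[OF A] card by (auto simp: all_less_6 reach_def)
    next
      case False
      have r: "reach K ?n ?a (i - 1)" if "reach K (card (branch x)) (card A) i" for i
        using that card by (auto simp: reach_def)
      show ?thesis
        using False seen(1,2)[OF A] r[of 3] r[of 4] r[of 5]
          seen(3)[OF A, of 2] seen(3)[OF A, of 3] seen(3)[OF A, of 4]
        by (simp add: all_less_6)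
    qed
  qed
  then show "\<exists>c. graded K x ps c" by blast
qed

text \<open>
  The vertex, its parent and its two children show \<open>t0\<close> to \<open>t3\<close>, so only \<open>t4\<close> (for order at
  least 4) and \<open>t5\<close> (for order at least 5) are to be arranged. Put them third and fourth for both
  children. Then \<open>t4\<close> is seen, since some child branch receives two vertices, and so is \<open>t5\<close> if
  one receives three, or if both receive two and one of them has order at least 3 and shows its
  fourth color as a bonus. If both branches have order exactly 2, the children use \<open>t4\<close> and \<open>t5\<close>
  in opposite order instead: a set of order 4 meets both branches, and a single vertex in such a
  branch already shows its third color, as a bonus.
\<close>

lemma gradable_two_children:
  assumes x: "x \<in> V" and ch: "children x = {y, z}" "y \<noteq> z" and gr: "gradable 3 y" "gradable 3 z"
  shows "gradable 3 x"
  unfolding gradable_def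
proof (intro allI impI)
  fix ps assume "ordering ps"
  then obtain t0 t1 t2 t3 t4 t5 where ps: "ps = [t0, t1, t2, t3, t4, t5]"
    and t: "distinct [t0, t1, t2, t3, t4, t5]" "{t0, t1, t2, t3, t4, t5} \<subseteq> {1..6}"
    by (rule list_of_ordering)
  let ?n = "\<lambda>y. card (branch y)" and ?a = "\<lambda>A y. card (A \<inter> branch y)"
  define qs where "qs = (if ?n y = 2 \<and> ?n z = 2 then [t1, t3, t5, t4] else [t1, t3, t4, t5])"
  obtain c where c: "valid_below x c" "c x = t1" and
    seen1: "\<And>A. subtree_at x A \<Longrightarrow> t1 \<in> c ` down A" and
    seen23: "\<And>A w. subtree_at x A \<Longrightarrow> w \<in> children x \<Longrightarrow>
       (if w = y then [t1, t2, t4, t5] else qs) ! 1 \<in> c ` down A" and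
    seen: "\<And>A w i. subtree_at x A \<Longrightarrow> w \<in> children x \<Longrightarrow> 0 < ?a A w \<Longrightarrow>
       i < length (if w = y then [t1, t2, t4, t5] else qs) \<Longrightarrow> reach 3 (?n w) (?a A w) i \<Longrightarrow>
       (if w = y then [t1, t2, t4, t5] else qs) ! i \<in> c ` down A"
    by (rule glue_child_colorings[of x t1 3 "\<lambda>w. if w = y then [t1, t2, t4, t5] else qs"])
      (use x gr t ch in \<open>auto simp: qs_def\<close>)
  have "graded 3 x ps c"
    unfolding ps
  proof (rule gradedI[OF c])
    fix A assume A: "subtree_at x A"
    have card: "card A = Suc (?a A y + ?a A z)" "card (branch x) = Suc (?n y + ?n z)"
      using card_below[OF x, of A] card_branch[OF x] ch A by (auto simp: subtree_at_def)
    have le: "?a A y \<le> ?n y" "?a A z \<le> ?n z" using card_part_le ch by blast+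
    have s: "t1 \<in> c ` down A" "t2 \<in> c ` down A" "t3 \<in> c ` down A"
      using seen1[OF A] seen23[OF A, of y] seen23[OF A, of z] ch by (auto simp: qs_def split: if_splits)
    have y4: "t4 \<in> c ` down A" if "2 \<le> ?a A y \<or> (?a A y = 1 \<and> 2 \<le> ?n y)"
      using that seen[OF A, of y 2] ch by (auto simp: reach_def)
    have y5: "t5 \<in> c ` down A" if "3 \<le> ?a A y \<or> (?a A y = 2 \<and> 3 \<le> ?n y)"
      using that seen[OF A, of y 3] ch by (auto simp: reach_def)
    have z4: "qs ! 2 \<in> c ` down A" if "2 \<le> ?a A z \<or> (?a A z = 1 \<and> 2 \<le> ?n z)"
      using that seen[OF A, of z 2] ch by (auto simp: reach_def qs_def split: if_splits)
    have z5: "qs ! 3 \<in> c ` down A" if "3 \<le> ?a A z \<or> (?a A z = 2 \<and> 3 \<le> ?n z)"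
      using that seen[OF A, of z 3] ch by (auto simp: reach_def qs_def split: if_splits)
    have "t4 \<in> c ` down A" if "reach 3 (card (branch x)) (card A) 4"
    proof (cases "?n y = 2 \<and> ?n z = 2")
      case True
      then have "1 \<le> ?a A y" using that card le by (auto simp: reach_def)
      then show ?thesis using y4 True by linarith
    next
      case False
      then have "qs = [t1, t3, t4, t5]" by (auto simp: qs_def)
      moreover have "2 \<le> ?a A y \<or> 2 \<le> ?a A z" using that card by (auto simp: reach_def)
      ultimately show ?thesis using y4 z4 by auto
    qed
    moreover have "t5 \<in> c ` down A" if "reach 3 (card (branch x)) (card A) 5"
    proof (cases "?n y = 2 \<and> ?n z = 2")
      case True
      then have "1 \<le> ?a A z" "qs = [t1, t3, t5, t4]"
        using that card le by (auto simp: reach_def qs_def)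
      then show ?thesis using z4 True le by (cases "?a A z = 1") auto
    next
      case False
      then have "qs = [t1, t3, t4, t5]" by (auto simp: qs_def)
      moreover have "3 \<le> ?a A y \<or> 3 \<le> ?a A z \<or> (2 \<le> ?a A y \<and> 2 \<le> ?a A z)"
        using that card by (auto simp: reach_def)
      moreover have "?n y \<noteq> 2 \<or> ?n z \<noteq> 2" using False by blast
      ultimately show ?thesis using y5 z5 le 
        by (metis (no_types, lifting) Suc_leI le_neq_implies_less nth_Cons_0 nth_Cons_Suc 
            numeral_2_eq_2 numeral_3_eq_3)
    qed
    ultimately show "\<forall>i<6. reach 3 (card (branch x)) (card A) i \<longrightarrow>
        [t0, t1, t2, t3, t4, t5] ! i \<in> insert t0 (c ` down A)"
      using s by (simp add: all_less_6)
  qed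
  then show "\<exists>c. graded 3 x ps c" by blast
qed

text \<open>
  Only \<open>t5\<close> is left to be arranged, and only for order at least 5. The four vertices below \<open>x\<close> cannot
  lie in three different branches, so some child branch receives two vertices and shows its third
  color.
\<close>

lemma gradable_three_children:
  assumes x: "x \<in> V" and ch: "card (children x) = 3" and gr: "\<And>y. y \<in> children x \<Longrightarrow> gradable 3 y"
  shows "gradable 3 x"
  unfolding gradable_def
proof (intro allI impI)
  fix ps assume "ordering ps"
  then obtain t0 t1 t2 t3 t4 t5 where ps: "ps = [t0, t1, t2, t3, t4, t5]"
    and t: "distinct [t0, t1, t2, t3, t4, t5]" "{t0, t1, t2, t3, t4, t5} \<subseteq> {1..6}"
    by (rule list_of_ordering)
  obtain f where f: "bij_betw f (children x) {t2, t3, t4}"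
    using finite_same_card_bij[OF finite_children, of "{t2, t3, t4}" x] ch t by auto
  have ft: "f y = t2 \<or> f y = t3 \<or> f y = t4" if "y \<in> children x" for y
    using f that by (auto simp: bij_betw_def)
  let ?n = "\<lambda>y. card (branch y)" and ?a = "\<lambda>A y. card (A \<inter> branch y)"
  obtain c where c: "valid_below x c" "c x = t1" and
    seen1: "\<And>A. subtree_at x A \<Longrightarrow> t1 \<in> c ` down A" and
    seen2: "\<And>A y. subtree_at x A \<Longrightarrow> y \<in> children x \<Longrightarrow> [t1, f y, t5] ! 1 \<in> c ` down A" and
    seen: "\<And>A y i. subtree_at x A \<Longrightarrow> y \<in> children x \<Longrightarrow> 0 < ?a A y \<Longrightarrow>
       i < length [t1, f y, t5] \<Longrightarrow> reach 3 (?n y) (?a A y) i \<Longrightarrow> [t1, f y, t5] ! i \<in> c ` down A"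
    by (rule glue_child_colorings[of x t1 3 "\<lambda>y. [t1, f y, t5]"]) (use x gr t ft in force)+
  have "graded 3 x ps c"
    unfolding ps
  proof (rule gradedI[OF c])
    fix A assume A: "subtree_at x A"
    have "f ` children x \<subseteq> c ` down A" using seen2[OF A] by auto
    then have s: "t2 \<in> c ` down A" "t3 \<in> c ` down A" "t4 \<in> c ` down A"
      using f by (auto simp: bij_betw_def)
    have "t5 \<in> c ` down A" if "reach 3 (card (branch x)) (card A) 5"
    proof -
      have "\<exists>y\<in>children x. 2 \<le> ?a A y"
      proof (rule ccontr)
        assume "\<not> ?thesis"
        then have "(\<Sum>y\<in>children x. ?a A y) \<le> card (children x) * 1"
          by (intro sum_bounded_above[where 'a = nat, simplified]) (auto simp: not_le)
        then show False
          using that card_below[OF x, of A] A ch by (auto simp: subtree_at_def reach_def)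
      qed
      then obtain y where "y \<in> children x" "2 \<le> ?a A y" by blast
      then show ?thesis using seen[OF A, of y 2] by (auto simp: reach_def)
    qed
    then show "\<forall>i<6. reach 3 (card (branch x)) (card A) i \<longrightarrow>
        [t0, t1, t2, t3, t4, t5] ! i \<in> insert t0 (c ` down A)"
      using s seen1[OF A] by (simp add: all_less_6)
  qed
  then show "\<exists>c. graded 3 x ps c" by blast
qed

lemma image_eq_if_card_le:
  assumes "finite A" "finite B" "B \<noteq> {}" "card B \<le> card A"
  shows "\<exists>f. f ` A = B"
  using assms inj_on_iff_card_le[of B A] inj_on_iff_surj[of B A] by blast

text \<open>
  Together with its parent and four differently colored children, \<open>x\<close> sees all colors on its own.
\<close>

lemma gradable_many_children:
  assumes x: "x \<in> V" and ch: "4 \<le> card (children x)" and gr: "\<And>y. y \<in> children x \<Longrightarrow> gradable K y"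
  shows "gradable K x"
  unfolding gradable_def
proof (intro allI impI)
  fix ps assume "ordering ps"
  then obtain t0 t1 t2 t3 t4 t5 where ps: "ps = [t0, t1, t2, t3, t4, t5]"
    and t: "distinct [t0, t1, t2, t3, t4, t5]" "{t0, t1, t2, t3, t4, t5} \<subseteq> {1..6}"
    by (rule list_of_ordering)
  obtain f where f: "f ` children x = {t2, t3, t4, t5}"
    using image_eq_if_card_le[OF finite_children, of "{t2, t3, t4, t5}" x] ch t by auto
  have ft: "f y = t2 \<or> f y = t3 \<or> f y = t4 \<or> f y = t5" if "y \<in> children x" for y
    using f that by auto
  obtain c where c: "valid_below x c" "c x = t1" and
    seen1: "\<And>A. subtree_at x A \<Longrightarrow> t1 \<in> c ` down A" and
    seen2: "\<And>A y. subtree_at x A \<Longrightarrow> y \<in> children x \<Longrightarrow> [t1, f y] ! 1 \<in> c ` down A"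
    by (rule glue_child_colorings[of x t1 K "\<lambda>y. [t1, f y]", OF x _ gr]) (use t ft in force)+
  have "graded K x ps c"
    unfolding ps
  proof (rule gradedI[OF c])
    fix A assume A: "subtree_at x A"
    have "f ` children x \<subseteq> c ` down A" using seen2[OF A] by auto
    then show "\<forall>i<6. reach K (card (branch x)) (card A) i \<longrightarrow>
        [t0, t1, t2, t3, t4, t5] ! i \<in> insert t0 (c ` down A)"
      using seen1[OF A] unfolding f by (simp add: all_less_6)
  qed
  then show "\<exists>c. graded K x ps c" by blast
qed

lemma card_child_branch_less:
  assumes "x \<in> V" "y \<in> children x" shows "card (branch y) < card (branch x)"
  using not_in_child_branch[OF assms(2)] child_branch_subset[OF assms(2)] branch_self[of x]
    finite_branch[OF assms(1)]
  by (intro psubset_card_mono) auto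

lemma gradable_3: "x \<in> V \<Longrightarrow> gradable 3 x"
proof (induction "card (branch x)" arbitrary: x rule: less_induct)
  case less
  have IH: "gradable 3 y" if "y \<in> children x" for y
    using less that card_child_branch_less by (auto simp: children_def)
  consider "card (children x) = 0" | "card (children x) = 1" | "card (children x) = 2"
    | "card (children x) = 3" | "4 \<le> card (children x)" by linarith
  then show ?case
  proof cases
    case 1 then show ?thesis using gradable_leaf less finite_children by simp
  next
    case 2
    then obtain y where "children x = {y}" by (auto simp: card_1_singleton_iff)
    then show ?thesis using gradable_one_child less.prems IH by blast
  next
    case 3
    then obtain y z where "children x = {y, z}" "y \<noteq> z" by (auto simp: card_2_iff)
    then show ?thesis using gradable_two_children less.prems IH by blast
  next
    case 4 then show ?thesis using gradable_three_children less IH by blast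
  next
    case 5 then show ?thesis using gradable_many_children less IH by blast
  qed
qed

text \<open>
  Without branching below the root, the induction meets only leaves and vertices with one child, and
  these put no bound on the bonus color.
\<close>

lemma gradable_chain:
  assumes "\<And>v. v \<in> V \<Longrightarrow> v \<noteq> r \<Longrightarrow> card (children v) \<le> 1"
  shows "x \<in> V \<Longrightarrow> x \<noteq> r \<Longrightarrow> gradable K x"
proof (induction "card (branch x)" arbitrary: x rule: less_induct)
  case less
  have IH: "gradable K y" if "y \<in> children x" for y
    using less that card_child_branch_less by (auto simp: children_def)
  have "card (children x) = 0 \<or> card (children x) = 1"
    using assms[of x] less.prems by linarith
  then show ?case
  proof
    assume "card (children x) = 0"
    then show ?thesis using gradable_leaf less finite_children by simp
  next
    assume "card (children x) = 1"
    then obtain y where "children x = {y}" by (auto simp: card_1_singleton_iff)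
    then show ?thesis using gradable_one_child less.prems IH by blast
  qed
qed

section \<open>Colorings of the whole tree\<close>

text \<open>
  Connected sets with top \<open>r\<close> have no parent above them, so their downward neighbourhood alone has
  to show all colors.
\<close>

definition full :: "('a \<Rightarrow> nat) \<Rightarrow> bool" where
  "full c \<longleftrightarrow> valid_below r c \<and>
     (\<forall>A. subtree_at r A \<longrightarrow> 5 \<le> card A \<longrightarrow> {1..6} \<subseteq> c ` down A)"

lemma atLeastAtMost_1_6: "{1..6::nat} = {1, 2, 3, 4, 5, 6}"
  by auto

text \<open>
  A connected set of order at least 5 has at least four vertices below \<open>r\<close>, in a branch of order at
  least 5. Either it has five of them, or the bonus color at position 5 completes the six colors.
\<close>

lemma full_path:
  assumes "card (children r) = 1" "\<And>v. v \<in> V \<Longrightarrow> v \<noteq> r \<Longrightarrow> card (children v) \<le> 1" "6 \<le> card V"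
  shows "\<exists>c. full c"
proof -
  obtain y where ch: "children r = {y}" using assms(1) by (auto simp: card_1_singleton_iff)
  then have y: "gradable 5 y" using gradable_chain[OF assms(2), of y 5] by (auto simp: children_def)
  obtain c where c: "valid_below r c" "c r = 1" and
    seen: "\<And>A. subtree_at r A \<Longrightarrow> 1 \<in> c ` down A"
    "\<And>A i. subtree_at r A \<Longrightarrow> 0 < card (A \<inter> branch y) \<Longrightarrow>
       i < 6 \<Longrightarrow> reach 5 (card (branch y)) (card (A \<inter> branch y)) i \<Longrightarrow>
       [1, 2, 3, 4, 5, 6] ! i \<in> c ` down A"
    by (rule glue_child_colorings[of r 1 5 "\<lambda>_. [1, 2, 3, 4, 5, 6]"]) (use root_in_V y ch in auto)
  have "full c"
    unfolding full_def
  proof (intro conjI allI impI c(1))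
    fix A assume A: "subtree_at r A" "5 \<le> card A"
    have card: "card A = Suc (card (A \<inter> branch y))" "card V = Suc (card (branch y))"
      using card_below[OF root_in_V, of A] card_branch[OF root_in_V] ch A
      by (auto simp: subtree_at_def branch_root)
    have "reach 5 (card (branch y)) (card (A \<inter> branch y)) i" if "i < 6" for i
      using that A card assms(3) by (auto simp: reach_def)
    with A card seen(2)[OF A(1), of 1] seen(2)[OF A(1), of 2] seen(2)[OF A(1), of 3]
      seen(2)[OF A(1), of 4] seen(2)[OF A(1), of 5]
    show "{1..6} \<subseteq> c ` down A"
      using seen(1)[OF A(1)] unfolding atLeastAtMost_1_6 by simp
  qed
  then show ?thesis by blast
qed

lemma full_five_children:
  assumes ch: "5 \<le> card (children r)"
  shows "\<exists>c. full c"
proof -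
  obtain f where f: "f ` children r = {2::nat, 3, 4, 5, 6}"
    using image_eq_if_card_le[OF finite_children, of "{2::nat, 3, 4, 5, 6}" r] ch by auto
  have child: "gradable 3 y" if "y \<in> children r" for y
    using that gradable_3 by (auto simp: children_def)
  have len: "distinct [1, f y] \<and> set [1, f y] \<subseteq> {1..6} \<and> 2 \<le> length [1, f y] \<and> [1, f y] ! 0 = 1"
    if "y \<in> children r" for y
  proof -
    have "f y \<in> {2, 3, 4, 5, 6}" using f that by blast
    then show ?thesis by auto
  qed
  obtain c where c: "valid_below r c" "c r = 1" and
    seen1: "\<And>A. subtree_at r A \<Longrightarrow> 1 \<in> c ` down A" and
    seen2: "\<And>A y. subtree_at r A \<Longrightarrow> y \<in> children r \<Longrightarrow> [1, f y] ! 1 \<in> c ` down A"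
    by (rule glue_child_colorings[of r 1 3 "\<lambda>y. [1, f y]", OF root_in_V _ child len]) auto
  have "{1..6} \<subseteq> c ` down A" if A: "subtree_at r A" for A
  proof -
    have "f ` children r \<subseteq> c ` down A" using seen2[OF A] by auto
    then show ?thesis using seen1[OF A] unfolding f atLeastAtMost_1_6 by simp
  qed
  then show ?thesis using c unfolding full_def by blast
qed

text \<open>
  The root and its children show 1 to 5. The color 6 is third for every child, so it is missed only
  if every branch that is met is met in its top alone and has order 1; as four vertices below
  the root are needed, all four branches then have order 1, and the tree has order 5.
\<close>

lemma full_four_children:
  assumes ch: "card (children r) = 4" and V: "6 \<le> card V"
  shows "\<exists>c. full c"
proof -
  let ?n = "\<lambda>y. card (branch y)" and ?a = "\<lambda>A y. card (A \<inter> branch y)"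
  have child: "y \<in> V" "gradable 3 y" if "y \<in> children r" for y
    using that gradable_3 by (auto simp: children_def)
  obtain f where f: "bij_betw f (children r) {2::nat, 3, 4, 5}"
    using finite_same_card_bij[OF finite_children, of "{2::nat, 3, 4, 5}" r] ch by auto
  have len: "distinct [1, f y, 6] \<and> set [1, f y, 6] \<subseteq> {1..6} \<and> 2 \<le> length [1, f y, 6] \<and>
      [1, f y, 6] ! 0 = 1" if "y \<in> children r" for y
  proof -
    have "f y \<in> {2, 3, 4, 5}" using f that by (blast dest: bij_betw_apply)
    then show ?thesis by auto
  qed
  obtain c where c: "valid_below r c" "c r = 1" and
    seen1: "\<And>A. subtree_at r A \<Longrightarrow> 1 \<in> c ` down A" and
    seen2: "\<And>A y. subtree_at r A \<Longrightarrow> y \<in> children r \<Longrightarrow> [1, f y, 6] ! 1 \<in> c ` down A" and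
    seen: "\<And>A y i. subtree_at r A \<Longrightarrow> y \<in> children r \<Longrightarrow> 0 < ?a A y \<Longrightarrow>
       i < length [1, f y, 6] \<Longrightarrow> reach 3 (?n y) (?a A y) i \<Longrightarrow> [1, f y, 6] ! i \<in> c ` down A"
    by (rule glue_child_colorings[of r 1 3 "\<lambda>y. [1, f y, 6]", OF root_in_V _ child(2) len]) auto
  have "{1..6} \<subseteq> c ` down A" if A: "subtree_at r A" "5 \<le> card A" for A
  proof -
    have "f ` children r \<subseteq> c ` down A" using seen2[OF A(1)] by auto
    then have "{1, 2, 3, 4, 5} \<subseteq> c ` down A"
      using seen1[OF A(1)] f by (auto simp: bij_betw_def)
    moreover have "6 \<in> c ` down A"
    proof -
      have sum: "4 \<le> (\<Sum>y\<in>children r. ?a A y)"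
        using card_below[OF root_in_V, of A] A by (auto simp: subtree_at_def)
      have "5 \<le> (\<Sum>y\<in>children r. ?n y)"
        using card_branch[OF root_in_V] V by (simp add: branch_root)
      have "\<exists>y\<in>children r. 0 < ?a A y \<and> reach 3 (?n y) (?a A y) 2"
      proof (rule ccontr)
        assume "\<not> ?thesis"
        (* Not seeing the third color at y means that the branch is avoided or consists of y alone. *)
        then have *: "?a A y = 0 \<or> (?a A y = 1 \<and> ?n y = 1)" if "y \<in> children r" for y
          using that card_part_le[OF that, of A] by (force simp: reach_def)
        then have "?a A y \<le> 1" if "y \<in> children r" for y using that by fastforce
        moreover have "?a A y = 1" if "y \<in> children r" for y
        proof (rule ccontr)
          assume "?a A y \<noteq> 1"
          then have "?a A y = 0" using * that by blast
          then have "(\<Sum>y\<in>children r. ?a A y) = (\<Sum>y\<in>children r - {y}. ?a A y)"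
            using that finite_children by (simp add: sum.remove)
          also have "\<dots> \<le> (\<Sum>y\<in>children r - {y}. 1)"
            using \<open>\<And>y. y \<in> children r \<Longrightarrow> ?a A y \<le> 1\<close> by (intro sum_mono) auto
          also have "\<dots> = 3" using that ch finite_children by simp
          finally show False using sum by simp
        qed
        ultimately have "?n y = 1" if "y \<in> children r" for y using * that by fastforce
        then have "(\<Sum>y\<in>children r. ?n y) = 4" using ch by simp
        then show False using \<open>5 \<le> (\<Sum>y\<in>children r. ?n y)\<close> by simp
      qed
      then show ?thesis using seen[OF A(1), of _ 2] by auto
    qed
    ultimately show ?thesis unfolding atLeastAtMost_1_6 by blast
  qed
  then show ?thesis using c unfolding full_def by blast
qed

text \<open>
  The root and its children show 1 to 4; the colors 5 and 6 are third and fourth for each child, in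
  an order that depends on the branch. A branch of order at least 3 that receives two vertices shows
  both. The critical branches are those of order 2, which never show more than their third color,
  but show it as soon as they are met. Two such branches are therefore given different third colors;
  a single one is given the third color opposite to that of \<open>x\<close>, so that it and \<open>x\<close> complement each
  other.
\<close>

lemma full_three_children:
  assumes ch: "children r = {x, y, z}" "x \<noteq> y" "x \<noteq> z" "y \<noteq> z" 
   and n: "card (branch y) = 2 \<and> card (branch z) = 2 \<and> card (branch x) \<noteq> 2 \<or>
       3 \<le> card (branch x) \<and> card (branch z) \<noteq> 2"
  shows "\<exists>c. full c"
proof -
  let ?n = "\<lambda>y. card (branch y)" and ?a = "\<lambda>A y. card (A \<inter> branch y)"
  have child: "y \<in> V" "gradable 3 y" if "y \<in> children r" for y
    using that gradable_3 by (auto simp: children_def)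
  define py where "py = (if ?n y = 2 \<and> ?n z \<noteq> 2 then [1::nat, 3, 6, 5] else [1, 3, 5, 6])"
  define pz where "pz = (if ?n z = 2 then [1::nat, 4, 6, 5] else [1, 4, 5, 6])"
  define ps where "ps w = (if w = x then [1, 2, 5, 6] else if w = y then py else pz)" for w
  have ps: "ps x = [1, 2, 5, 6]" "ps y = py" "ps z = pz" using ch by (auto simp: ps_def)
  have len: "distinct (ps w)" "set (ps w) \<subseteq> {1..6}" "length (ps w) = 4" "ps w ! 0 = 1" for w
    by (simp_all add: ps_def py_def pz_def)
  obtain c where c: "valid_below r c" "c r = 1" and
    seen1: "\<And>A. subtree_at r A \<Longrightarrow> 1 \<in> c ` down A" and
    seen2: "\<And>A y. subtree_at r A \<Longrightarrow> y \<in> children r \<Longrightarrow> ps y ! 1 \<in> c ` down A" and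
    seen: "\<And>A y i. subtree_at r A \<Longrightarrow> y \<in> children r \<Longrightarrow> 0 < ?a A y \<Longrightarrow>
       i < length (ps y) \<Longrightarrow> reach 3 (?n y) (?a A y) i \<Longrightarrow> ps y ! i \<in> c ` down A"
    by (rule glue_child_colorings[of r 1 3 ps]) (use root_in_V child len in auto)
  have "{1..6} \<subseteq> c ` down A" if A: "subtree_at r A" "5 \<le> card A" for A
  proof -
    have sum: "4 \<le> ?a A x + ?a A y + ?a A z"
      using card_below[OF root_in_V, of A] A ch by (auto simp: subtree_at_def)
    have le: "?a A x \<le> ?n x" "?a A y \<le> ?n y" "?a A z \<le> ?n z"
      using card_part_le ch by blast+
    have s: "1 \<in> c ` down A" "2 \<in> c ` down A" "3 \<in> c ` down A" "4 \<in> c ` down A"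
      using seen1[OF A(1)] seen2[OF A(1), of x] seen2[OF A(1), of y] seen2[OF A(1), of z] ch
      unfolding ps by (auto simp: py_def pz_def split: if_splits)
    have third: "ps w ! 2 \<in> c ` down A"
      if "w \<in> {x, y, z}" "2 \<le> ?a A w \<or> (?a A w = 1 \<and> 2 \<le> ?n w)" for w
      using that seen[OF A(1), of w 2] ch(1) by (auto simp: reach_def len)
    have fourth: "ps w ! 3 \<in> c ` down A"
      if "w \<in> {x, y, z}" "3 \<le> ?a A w \<or> (?a A w = 2 \<and> 3 \<le> ?n w)" for w
      using that seen[OF A(1), of w 3] ch(1) by (auto simp: reach_def len)
    have both: "5 \<in> c ` down A \<and> 6 \<in> c ` down A"
      if "w \<in> {x, y, z}" "2 \<le> ?a A w" "3 \<le> ?n w" for w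
    proof -
      have "3 \<le> ?a A w \<or> (?a A w = 2 \<and> 3 \<le> ?n w)" using that by linarith
      then have "ps w ! 2 \<in> c ` down A" "ps w ! 3 \<in> c ` down A"
        using third fourth that by blast+
      moreover have "{ps w ! 2, ps w ! 3} = {5, 6}" by (auto simp: ps_def py_def pz_def)
      ultimately have "{5, 6} \<subseteq> c ` down A" by (metis empty_subsetI insert_subset)
      then show ?thesis by simp
    qed
    have "5 \<in> c ` down A \<and> 6 \<in> c ` down A"
    proof (cases "\<exists>w\<in>{x, y, z}. 2 \<le> ?a A w \<and> 3 \<le> ?n w")
      case True
      then show ?thesis using both by blast
    next
      case no_big: False
      show ?thesis
      proof (cases "?n z = 2")
        case True
        (* Whether its order is 1 or at least 3, the branch of x receives at most one vertex here,
           so those of y and z are both met. *)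
        with n have "?n y = 2" "?n x \<noteq> 2" by auto
        moreover have "?a A x \<le> 1" using no_big le \<open>?n x \<noteq> 2\<close> by fastforce
        ultimately have "?a A y \<noteq> 0" "?a A z \<noteq> 0" using sum True le by linarith+
        then have "ps y ! 2 \<in> c ` down A" "ps z ! 2 \<in> c ` down A"
          using third \<open>?n y = 2\<close> True by force+
        then show ?thesis unfolding ps py_def pz_def using \<open>?n y = 2\<close> True by simp
      next
        case False
        with n have nx: "3 \<le> ?n x" by blast
        then have a: "?a A x \<le> 1" "?a A z \<le> 1" using no_big le False by force+
        then have "2 \<le> ?a A y" "1 = ?a A x" using sum no_big le nx by force+
        then have "?n y = 2" using no_big le by force
        (* Here x contributes 5 as a bonus and y contributes 6. *)
        have "ps x ! 2 \<in> c ` down A" "ps y ! 2 \<in> c ` down A"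
          using third[of x] third[of y] \<open>2 \<le> ?a A y\<close> \<open>1 = ?a A x\<close> nx by auto
        then show ?thesis unfolding ps py_def using \<open>?n y = 2\<close> False by simp
      qed
    qed
    then show ?thesis unfolding atLeastAtMost_1_6 using s by blast
  qed
  then show ?thesis using c unfolding full_def by blast
qed

text \<open>
  The three cases for the degree of the root. With three children, order at least 6 leaves these
  possibilities: some branch has order at least 3, or two branches have order 2 and the third has
  order 1, or all three have order 2.
\<close>

lemma full_or_spider:
  assumes V: "6 \<le> card V" and deg: "3 \<le> card (children r)"
    and no_spider: "\<And>x y z. children r = {x, y, z} \<Longrightarrow> distinct [x, y, z] \<Longrightarrow>
      card (branch x) = 2 \<Longrightarrow> card (branch y) = 2 \<Longrightarrow> card (branch z) = 2 \<Longrightarrow> False"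
  shows "\<exists>c. full c"
proof -
  consider "5 \<le> card (children r)" | "card (children r) = 4" | "card (children r) = 3"
    using deg by linarith
  then show ?thesis
  proof cases
    case 1 then show ?thesis by (rule full_five_children)
  next
    case 2 then show ?thesis using V by (rule full_four_children)
  next
    case 3
    let ?n = "\<lambda>y. card (branch y)"
    obtain x y z where ch: "children r = {x, y, z}" "x \<noteq> y" "x \<noteq> z" "y \<noteq> z"
      using 3 by (auto simp: card_3_iff)
    have sum: "5 \<le> ?n x + ?n y + ?n z"
      using card_branch[OF root_in_V] V ch by (simp add: branch_root)
    (* The roles of the children may be permuted. *)
    have two: "\<exists>c. full c"
      if "{x, y, z} = {u, v, w}" "u \<noteq> v" "u \<noteq> w" "v \<noteq> w"
        "?n v = 2 \<and> ?n w = 2 \<and> ?n u \<noteq> 2 \<or> 3 \<le> ?n u \<and> ?n w \<noteq> 2" for u v w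
      using full_three_children[of u v w] that ch by blast
    have big: "\<exists>c. full c"
      if "{x, y, z} = {u, v, w}" "u \<noteq> v" "u \<noteq> w" "v \<noteq> w" "3 \<le> ?n u" for u v w
    proof (cases "?n w = 2")
      case True
      show ?thesis
      proof (cases "?n v = 2")
        case True with two[OF that(1-4)] \<open>?n w = 2\<close> that(5) show ?thesis by simp
      next
        case False with two[of u w v] that show ?thesis by (simp add: insert_commute)
      qed
    next
      case False with two[OF that(1-4)] that(5) show ?thesis by blast
    qed
    consider "3 \<le> ?n x" | "3 \<le> ?n y" | "3 \<le> ?n z" | "?n x \<le> 2" "?n y \<le> 2" "?n z \<le> 2"
      by linarith
    then show ?thesis
    proof cases
      case 1 then show ?thesis using big[of x y z] ch by blast
    next
      case 2 then show ?thesis using big[of y x z] ch by blast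
    next
      case 3 then show ?thesis using big[of z x y] ch by blast
    next
      case 4
      have "\<not> (?n x = 2 \<and> ?n y = 2 \<and> ?n z = 2)"
        using no_spider[of x y z] ch by auto
      with 4 sum consider "?n y = 2 \<and> ?n z = 2 \<and> ?n x \<noteq> 2" | "?n x = 2 \<and> ?n z = 2 \<and> ?n y \<noteq> 2"
        | "?n x = 2 \<and> ?n y = 2 \<and> ?n z \<noteq> 2"
        by linarith
      then show ?thesis
      proof cases
        case 1 then show ?thesis using two[of x y z] ch by blast
      next
        case 2 then show ?thesis using two[of y x z] ch by blast
      next
        case 3 then show ?thesis using two[of z x y] ch by blast
      qed
    qed
  qed
qed

section \<open>Connected sets\<close>

text \<open>
  The top is a vertex \<open>t\<close> of least depth. If the parent of \<open>v\<close> is outside \<open>A\<close>, then no walk inside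
  \<open>A\<close> leaves the branch of \<open>v\<close>, so \<open>t\<close> lies in that branch, which forces \<open>v = t\<close>.
\<close>

lemma connected_set_has_top:
  assumes "A \<subseteq> V" "A \<noteq> {}"
    and conn: "\<And>u v. u \<in> A \<Longrightarrow> v \<in> A \<Longrightarrow> (u, v) \<in> ((up \<union> up\<inverse>) \<inter> A \<times> A)\<^sup>*"
  obtains t where "subtree_at t A"
proof -
  obtain t where t: "t \<in> A" "\<And>v. v \<in> A \<Longrightarrow> dep t \<le> dep v"
    using assms(2) ex_has_least_nat[of "\<lambda>v. v \<in> A" _ dep] by blast
  have nr: "v \<noteq> r" if "v \<in> A" "v \<noteq> t" for v
    using that t dep_branch[of t r] assms(1) branch_root by fastforce
  have par: "par v \<in> A" if v: "v \<in> A" "v \<noteq> t" for v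
  proof (rule ccontr)
    assume out: "par v \<notin> A"
    have "(v, t) \<in> ((up \<union> up\<inverse>) \<inter> A \<times> A)\<^sup>*" using conn v t by blast
    then have "t \<in> branch v"
    proof (induction rule: rtrancl_induct)
      case base show ?case by (rule branch_self)
    next
      case (step w w')
      then have "w' \<in> A" "(w, w') \<in> up \<or> (w', w) \<in> up" by auto
      then show ?case
        using step.IH out par_in_branch[of w v]
        by (auto simp: up_iff branch_def intro: converse_rtrancl_into_rtrancl)
    qed
    then show False using dep_branch t(2)[of v] v by fastforce
  qed
  have "v \<in> branch t" if "v \<in> A" for v
    using that
  proof (induction "dep v" arbitrary: v rule: less_induct)
    case less
    show ?case
    proof (cases "v = t")
      case False
      then have "(v, par v) \<in> up" using less nr assms(1) by (auto simp: up_iff)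
      moreover have "par v \<in> branch t"
        using less False par nr dep_par assms(1) by blast
      ultimately show ?thesis
        by (auto simp: branch_def intro: converse_rtrancl_into_rtrancl)
    qed (simp add: branch_self)
  qed
  then show ?thesis using t par that unfolding subtree_at_def by blast
qed

text \<open>
  If \<open>A\<close> has its top below the root, the parent of the top supplies the color that may be missing
  on \<open>down A\<close>. The parent is adjacent to \<open>A\<close>, so in terms of the graph all colors occur on \<open>N[A]\<close>.
\<close>

lemma full_sees_all:
  assumes "full c" "A \<subseteq> V" "A \<noteq> {}" "5 \<le> card A"
    and "\<And>u v. u \<in> A \<Longrightarrow> v \<in> A \<Longrightarrow> (u, v) \<in> ((up \<union> up\<inverse>) \<inter> A \<times> A)\<^sup>*"
    and i: "i \<in> {1..6}"
  obtains v where "v \<in> V" "c v = i" "v \<in> A \<or> (\<exists>u\<in>A. (v, u) \<in> up \<union> up\<inverse>)"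
proof -
  obtain t where t: "subtree_at t A" using connected_set_has_top assms by metis
  then have "t \<in> A" by (simp add: subtree_at_def)
  have dn: "v \<in> V \<and> (v \<in> A \<or> (\<exists>u\<in>A. (v, u) \<in> up \<union> up\<inverse>))" if "v \<in> down A" for v
    using that assms(2) by (auto simp: down_def up_iff)
  show ?thesis
  proof (cases "t = r")
    case True
    then have "i \<in> c ` down A" using assms t unfolding full_def by blast
    then show ?thesis using dn that by blast
  next
    case False
    have "t \<in> branch r - {r}" using False \<open>t \<in> A\<close> assms(2) branch_root by blast
    then have "i \<in> insert (c (par t)) (c ` down A)"
      using assms t unfolding full_def valid_below_def by blast
    moreover have "par t \<in> V \<and> (\<exists>u\<in>A. (par t, u) \<in> up \<union> up\<inverse>)"
      using False \<open>t \<in> A\<close> assms(2) par_in_V by (auto simp: up_iff)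
    ultimately show ?thesis using dn that by blast
  qed
qed

end

section \<open>Trees as rooted trees\<close>

lemma mk_symmetric_arcs:
  assumes "pair_graph T"
  shows "parcs (mk_symmetric (with_proj T)) = parcs T" "pverts (mk_symmetric (with_proj T)) = pverts T"
proof -
  interpret pair_graph T by fact
  show "parcs (mk_symmetric (with_proj T)) = parcs T"
    using arcs_symmetric by (auto simp: mk_symmetric_def)
  show "pverts (mk_symmetric (with_proj T)) = pverts T"
    by (simp add: mk_symmetric_def)
qed

text \<open>
  A path from \<open>v\<close> back to \<open>u\<close> that avoids the edge would close up with it to a cycle. The cycle has
  length at least 3, since neither the empty walk nor the deleted arc \<open>(v, u)\<close> is available.
\<close>

lemma bridge_in_tree:
  assumes T: "undirected_tree T" and uv: "(u, v) \<in> parcs T"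
  shows "(v, u) \<notin> (parcs T - {(u, v), (v, u)})\<^sup>*"
proof
  interpret pair_graph T using T by (simp add: undirected_tree_def)
  define G where "G = \<lparr>pverts = pverts T, parcs = parcs T - {(u, v), (v, u)}\<rparr>"
  interpret G: pair_wf_digraph G
    using wellformed' by unfold_locales (auto simp: G_def)
  assume "(v, u) \<in> (parcs T - {(u, v), (v, u)})\<^sup>*"
  then have "v \<rightarrow>\<^sup>*\<^bsub>with_proj G\<^esub> u"
    using G.reachable_conv in_arcsD1[OF uv] in_arcsD2[OF uv] by (simp add: G_def)
  then obtain p where "G.awalk v p u" using G.reachable_awalk by auto
  then have "\<exists>p. G.apath v p u" using G.apath_awalk_to_apath by blast
  then obtain p where p: "G.apath v p u" by blast
  then have "G.awalk v p u" and dist: "distinct (pawalk_verts v p)"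
    by (simp_all add: G.apath_def)
  then have "v \<in> pverts G" "set p \<subseteq> parcs G" "pcas v p u" by (simp_all add: G.awalk_def)
  then have walk: "awalk v p u" and sub: "set p \<subseteq> parcs T - {(u, v), (v, u)}"
    by (auto simp: awalk_def G_def)
  have "2 \<le> length p"
  proof (rule ccontr)
    assume "\<not> 2 \<le> length p"
    then have "p = [] \<or> (\<exists>e. p = [e])" by (cases p) (auto simp: not_le)
    then show False
      using walk sub no_loops'[OF uv] by (auto simp: awalk_def)
  qed
  moreover have "cycle ((u, v) # p)"
    unfolding cycle_def using walk dist uv by (auto simp: awalk_Cons_iff)
  ultimately have "pre_digraph.cycle (with_proj T) ((u, v) # p)" "3 \<le> length ((u, v) # p)" by simp_all
  then show False using T unfolding undirected_tree_def by blast
qed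

text \<open>
  The depth is the distance to \<open>r\<close>, and a parent is any neighbour closer to \<open>r\<close>. An edge that does
  not join a vertex to its parent could be deleted without disconnecting its ends, as both still
  reach \<open>r\<close> through their parents; so no such edge exists.
\<close>

lemma tree_is_rooted_tree:
  assumes T: "undirected_tree T" and r: "r \<in> pverts T"
  obtains par dep where "rooted_tree (pverts T) r par dep"
    "parcs T = rooted_tree.up (pverts T) r par \<union> (rooted_tree.up (pverts T) r par)\<inverse>"
proof -
  have pg: "pair_graph T" using T by (simp add: undirected_tree_def)
  interpret pair_graph T by fact
  define dep where "dep v = (LEAST n. (v, r) \<in> parcs T ^^ n)" for v
  have "\<exists>w. (v, w) \<in> parcs T \<and> dep w < dep v" if v: "v \<in> pverts T" "v \<noteq> r" for v
  proof -
    have "v \<rightarrow>\<^sup>*\<^bsub>with_proj (mk_symmetric (with_proj T))\<^esub> r"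
      using T v r mk_symmetric_arcs[OF pg]
      by (simp add: undirected_tree_def connected_def strongly_connected_def)
    then have "(v, r) \<in> (parcs T)\<^sup>*"
      using mk_symmetric_arcs[OF pg] by (auto simp: reachable_def dest: rtrancl_on_rtranclI)
    then obtain n where "(v, r) \<in> parcs T ^^ n" using rtrancl_imp_relpow by blast
    then have d: "(v, r) \<in> parcs T ^^ dep v" unfolding dep_def by (rule LeastI)
    then obtain m where m: "dep v = Suc m" using v by (cases "dep v") auto
    then obtain w where "(v, w) \<in> parcs T" "(w, r) \<in> parcs T ^^ m"
      using d relpow_Suc_D2 by metis
    moreover from this have "dep w \<le> m" unfolding dep_def by (intro Least_le)
    ultimately show ?thesis using m by auto
  qed
  then obtain par where par: "\<And>v. v \<in> pverts T \<Longrightarrow> v \<noteq> r \<Longrightarrow> (v, par v) \<in> parcs T \<and> dep (par v) < dep v"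
    by metis
  interpret R: rooted_tree "pverts T" r par dep
    using par r in_arcsD2 pair_finite_verts by unfold_locales blast+
  have sub: "R.up \<subseteq> parcs T" using par by (auto simp: R.up_iff)
  have "(u, v) \<in> R.up \<union> R.up\<inverse>" if uv: "(u, v) \<in> parcs T" for u v
  proof (rule ccontr)
    assume "(u, v) \<notin> R.up \<union> R.up\<inverse>"
    then have up: "R.up \<subseteq> parcs T - {(u, v), (v, u)}" "R.up\<inverse> \<subseteq> parcs T - {(u, v), (v, u)}"
      using sub arcs_symmetric by auto
    have "(v, r) \<in> R.up\<^sup>*" "(u, r) \<in> R.up\<^sup>*"
      using R.branch_root in_arcsD1[OF uv] in_arcsD2[OF uv] by (auto simp: R.branch_def)
    then have "(v, r) \<in> R.up\<^sup>*" "(r, u) \<in> (R.up\<inverse>)\<^sup>*" by (auto intro: rtrancl_converseI)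
    then have "(v, u) \<in> (parcs T - {(u, v), (v, u)})\<^sup>*"
      using rtrancl_mono[OF up(1)] rtrancl_mono[OF up(2)] by (meson rtrancl_trans subsetD)
    then show False using bridge_in_tree[OF T uv] by blast
  qed
  then have "parcs T = R.up \<union> R.up\<inverse>" using sub arcs_symmetric by auto
  then show ?thesis using that R.rooted_tree_axioms by blast
qed

section \<open>Isolating color classes\<close>

text \<open>
  A component of order at least 5 left by deleting the closed neighbourhood of color class \<open>i\<close> would
  be a connected set that does not see the color \<open>i\<close>.
\<close>

lemma isolating_if_full:
  assumes pg: "pair_graph T" and "rooted_tree (pverts T) r par dep"
    and arcs: "parcs T = rooted_tree.up (pverts T) r par \<union> (rooted_tree.up (pverts T) r par)\<inverse>"
    and full: "rooted_tree.full (pverts T) r par c"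
  shows "star_coloring 6 T c \<and> (\<forall>i\<in>{1..6}. all_isolating 5 T (color_class T c i))"
proof (intro conjI ballI)
  interpret R: rooted_tree "pverts T" r par dep by fact
  have "c v \<in> {1..6}" "v \<noteq> r \<Longrightarrow> c v \<noteq> c (par v)" if "v \<in> pverts T" for v
    using full that R.branch_root by (auto simp: R.full_def R.valid_below_def)
  then show "star_coloring 6 T c"
    unfolding star_coloring_def arcs by (force simp: R.up_iff)
  fix i :: nat assume i: "i \<in> {1..6}"
  let ?W = "pverts T - closed_nbhd T (color_class T c i)"
  have False if H: "H \<in> pre_digraph.sccs (with_proj T \<restriction> ?W)" and big: "5 \<le> card (verts H)" for H
  proof -
    have ind: "induced_subgraph H (with_proj T \<restriction> ?W)" and sc: "strongly_connected H"
      using H by (auto simp: pre_digraph.sccs_def)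
    have sub: "verts H \<subseteq> ?W" and ne: "verts H \<noteq> {}"
      using ind sc by (auto simp: induced_subgraph_def subgraph_def strongly_connected_def)
    have ends: "arcs_ends H \<subseteq> parcs T"
      using ind by (auto simp: induced_subgraph_def subgraph_def compatible_def arcs_ends_def
          arc_to_ends_def)
    have "(u, v) \<in> ((R.up \<union> R.up\<inverse>) \<inter> verts H \<times> verts H)\<^sup>*"
      if uv: "u \<in> verts H" "v \<in> verts H" for u v
    proof -
      have "(u, v) \<in> rtrancl_on (verts H) (arcs_ends H)"
        using sc uv by (auto simp: strongly_connected_def reachable_def)
      then show ?thesis
      proof (induction rule: rtrancl_on_induct)
        case (step y z)
        then have "(y, z) \<in> (R.up \<union> R.up\<inverse>) \<inter> verts H \<times> verts H" using ends arcs by auto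
        with step.IH show ?case by (rule rtrancl_into_rtrancl)
      qed simp
    qed
    moreover have "verts H \<subseteq> pverts T" using sub by blast
    ultimately obtain v where
      v: "v \<in> pverts T" "c v = i" "v \<in> verts H \<or> (\<exists>u\<in>verts H. (v, u) \<in> R.up \<union> R.up\<inverse>)"
      using R.full_sees_all[OF full _ ne big _ i] by metis
    then have "v \<in> color_class T c i" by (simp add: color_class_def)
    then show False using v sub unfolding closed_nbhd_def arcs by blast
  qed
  then show "all_isolating 5 T (color_class T c i)"
    unfolding all_isolating_def by (auto simp: color_class_def)
qed

lemma small_graph_isolating:
  assumes "pair_graph T" "card (pverts T) < 5"
  shows "\<exists>c. star_coloring 6 T c \<and> (\<forall>i\<in>{1..6}. all_isolating 5 T (color_class T c i))"
proof -
  interpret pair_graph T by fact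
  obtain c where c: "inj_on c (pverts T)" "c ` pverts T \<subseteq> {1..6::nat}"
    using card_le_inj[OF pair_finite_verts, of "{1..6::nat}"] assms(2) by auto
  have "star_coloring 6 T c"
    unfolding star_coloring_def
  proof (intro conjI ballI)
    fix e assume e: "e \<in> parcs T"
    obtain u v where "e = (u, v)" by (cases e)
    then show "case e of (u, v) \<Rightarrow> c u \<noteq> c v"
      using e c(1) no_loops'[of u v] in_arcsD1[of u v] in_arcsD2[of u v] by (auto dest: inj_onD)
  qed (use c in auto)
  moreover have "all_isolating 5 T (color_class T c i)" for i
  proof -
    have "card (verts H) < 5"
      if "H \<in> pre_digraph.sccs (with_proj T \<restriction> (pverts T - W))" for H W
    proof -
      have "verts H \<subseteq> pverts T"
        using that by (auto simp: pre_digraph.sccs_def induced_subgraph_def subgraph_def)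
      then show ?thesis using assms(2) card_mono[OF pair_finite_verts] by (meson le_less_trans)
    qed
    then have "\<not> 5 \<le> card (verts H)"
      if "H \<in> pre_digraph.sccs (with_proj T \<restriction> (pverts T - W))" for H W
      using that by (meson not_le)
    moreover have "color_class T c i \<subseteq> pverts T" by (auto simp: color_class_def)
    ultimately show ?thesis unfolding all_isolating_def by blast
  qed
  ultimately show ?thesis by blast
qed

section \<open>The exceptional tree\<close>

lemma (in rooted_tree) branch_of_card_2:
  assumes "x \<in> V" "card (branch x) = 2"
  obtains x' where "branch x = {x, x'}" "x' \<noteq> x" "par x' = x" "x' \<in> V" "x' \<noteq> r"
proof -
  have "(\<Sum>y\<in>children x. card (branch y)) = 1" using card_branch assms by simp
  then obtain y where y: "y \<in> children x" by (cases "children x = {}") auto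
  have "y \<in> branch x" "y \<noteq> x"
    using y child_branch_subset branch_self not_in_child_branch by blast+
  then have "{x, y} = branch x"
    using assms branch_self[of x] finite_branch[OF assms(1)] by (intro card_subset_eq) auto
  then show ?thesis using y \<open>y \<noteq> x\<close> that[of y] by (auto simp: children_def)
qed

text \<open>
  Three branches of order 2 at the root are the three subdivided edges of the star.
\<close>

lemma spider_iso_O7:
  assumes "pair_graph T" "rooted_tree (pverts T) r par dep"
    and arcs: "parcs T = rooted_tree.up (pverts T) r par \<union> (rooted_tree.up (pverts T) r par)\<inverse>"
    and ch: "rooted_tree.children (pverts T) r par r = {x, y, z}" "distinct [x, y, z]"
    and two: "\<And>w. w \<in> {x, y, z} \<Longrightarrow> card (rooted_tree.branch (pverts T) r par w) = 2"
  shows "digraph_iso (with_proj T) (with_proj O7)"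
proof -
  interpret pair_graph T by fact
  interpret R: rooted_tree "pverts T" r par dep by fact
  have inV: "w \<in> pverts T" "w \<noteq> r" "par w = r" if "w \<in> {x, y, z}" for w
    using that ch by (auto simp: R.children_def)
  obtain x' where x': "R.branch x = {x, x'}" "x' \<noteq> x" "par x' = x" "x' \<in> pverts T" "x' \<noteq> r"
    using R.branch_of_card_2[of x] inV two by blast
  obtain y' where y': "R.branch y = {y, y'}" "y' \<noteq> y" "par y' = y" "y' \<in> pverts T" "y' \<noteq> r"
    using R.branch_of_card_2[of y] inV two by blast
  obtain z' where z': "R.branch z = {z, z'}" "z' \<noteq> z" "par z' = z" "z' \<in> pverts T" "z' \<noteq> r"
    using R.branch_of_card_2[of z] inV two by blast
  have V: "pverts T = {r, x, x', y, y', z, z'}"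
    using R.branch_unfold[of r] ch x' y' z' by (auto simp: R.branch_root)
  have "x \<noteq> r" "y \<noteq> r" "z \<noteq> r" using inV(2) by blast+
  moreover have "{x, x'} \<inter> {y, y'} = {}" "{x, x'} \<inter> {z, z'} = {}" "{y, y'} \<inter> {z, z'} = {}"
    unfolding x'(1)[symmetric] y'(1)[symmetric] z'(1)[symmetric]
    using R.child_branches_disjoint[of x r y] R.child_branches_disjoint[of x r z]
      R.child_branches_disjoint[of y r z] ch by simp_all
  ultimately have dist: "distinct [r, x, x', y, y', z, z']"
    using x'(2,5) y'(2,5) z'(2,5) by auto
  have "pverts T - {r} = {x, x', y, y', z, z'}" using V dist by auto
  moreover have "R.up = (\<lambda>v. (v, par v)) ` (pverts T - {r})" by (auto simp: R.up_def)
  moreover have "par x = r" "par y = r" "par z = r" using inV(3) by blast+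
  ultimately have "R.up = {(x, r), (x', x), (y, r), (y', y), (z, r), (z', z)}"
    by (simp add: x'(3) y'(3) z'(3))
  then have A: "parcs T = {(x, r), (x', x), (y, r), (y', y), (z, r), (z', z),
      (r, x), (x, x'), (r, y), (y, y'), (r, z), (z, z')}"
    unfolding arcs by auto
  (* O7 has centre 0, subdivision vertices 4, 5, 6 and leaves 1, 2, 3. *)
  define f where "f = (\<lambda>_. 0::nat)(x := 4, x' := 1, y := 5, y' := 2, z := 6, z' := 3)"
  have f: "f r = 0" "f x = 4" "f x' = 1" "f y = 5" "f y' = 2" "f z = 6" "f z' = 3"
    using dist by (auto simp: f_def)
  have inj: "inj_on f (pverts T)"
  proof -
    have "distinct (map f [r, x, x', y, y', z, z'])" using f by simp
    then have "inj_on f (set [r, x, x', y, y', z, z'])" using distinct_map by blast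
    then show ?thesis by (simp add: V)
  qed
  define h where "h = \<lparr>iso_verts = f, iso_arcs = map_prod f f, iso_head = snd, iso_tail = fst\<rparr>"
  have "pre_digraph.digraph_isomorphism (with_proj T) h"
    unfolding pre_digraph.digraph_isomorphism_def
  proof (intro conjI)
    show "wf_digraph (with_proj T)" by unfold_locales
    have "parcs T \<subseteq> pverts T \<times> pverts T" using in_arcsD1 in_arcsD2 by auto
    then have "inj_on (map_prod f f) (parcs T)"
      using map_prod_inj_on[OF inj inj] inj_on_subset by blast
    then show "inj_on (iso_arcs h) (arcs (with_proj T))" by (simp add: h_def)
  qed (use inj in \<open>auto simp: h_def\<close>)
  moreover have "with_proj O7 = app_iso h (with_proj T)"
    by (simp add: app_iso_def h_def with_proj_def pverts_O7 parcs_O7 V A f) auto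
  ultimately show ?thesis unfolding digraph_iso_def by blast
qed

section \<open>Six isolating color classes in a tree\<close>

theorem theorem7:
  fixes T :: "'a pair_pre_digraph"
  assumes "undirected_tree T"
    and "card (pverts T) \<noteq> 5"
    and "\<not> digraph_iso (with_proj T) (with_proj O7)"
  shows "\<exists>c. star_coloring 6 T c \<and> (\<forall>i\<in>{1..6}. all_isolating 5 T (color_class T c i))"
proof (cases "card (pverts T) < 5")
  case True
  then show ?thesis using small_graph_isolating[of T] assms(1) unfolding undirected_tree_def by blast
next
  case False
  with assms(2) have n: "6 \<le> card (pverts T)" by simp
  have pg: "pair_graph T" using assms(1) by (simp add: undirected_tree_def)
  interpret pair_graph T by fact
  let ?N = "\<lambda>v. {u. (v, u) \<in> parcs T}"
  show ?thesis
  proof (cases "\<exists>r\<in>pverts T. 3 \<le> card (?N r)")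
    case True
    then obtain r where r: "r \<in> pverts T" "3 \<le> card (?N r)" by blast
    obtain par dep where rt: "rooted_tree (pverts T) r par dep" and
      arcs: "parcs T = rooted_tree.up (pverts T) r par \<union> (rooted_tree.up (pverts T) r par)\<inverse>"
      using tree_is_rooted_tree[OF assms(1) r(1)] by blast
    interpret R: rooted_tree "pverts T" r par dep by fact
    have "?N r = R.children r" unfolding arcs by (auto simp: R.up_iff R.children_def)
    with r have "3 \<le> card (R.children r)" by simp
    then have "\<exists>c. R.full c"
    proof (rule R.full_or_spider[OF n])
      fix x y z assume "R.children r = {x, y, z}" "distinct [x, y, z]"
        "card (R.branch x) = 2" "card (R.branch y) = 2" "card (R.branch z) = 2"
      then show False using spider_iso_O7[OF pg rt arcs, of x y z] assms(3) by auto
    qed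
    then show ?thesis using isolating_if_full[OF pg rt arcs] by blast
  next
    case False
    then have deg: "card (?N v) \<le> 2" if "v \<in> pverts T" for v using that by force
    obtain r0 where r0: "r0 \<in> pverts T" using n by fastforce
    (* A vertex of greatest depth, for any choice of root, is a leaf. *)
    obtain r where r: "r \<in> pverts T" "card (?N r) = 1"
    proof -
      obtain par dep where "rooted_tree (pverts T) r0 par dep" and
        arcs: "parcs T = rooted_tree.up (pverts T) r0 par \<union> (rooted_tree.up (pverts T) r0 par)\<inverse>"
        using tree_is_rooted_tree[OF assms(1) r0] by blast
      then interpret R: rooted_tree "pverts T" r0 par dep by simp
      have fin: "finite (dep ` pverts T)" "dep ` pverts T \<noteq> {}" using R.finite_V r0 by auto
      obtain v where v: "v \<in> pverts T" "\<And>w. w \<in> pverts T \<Longrightarrow> dep w \<le> dep v"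
        using Max_in[OF fin] Max_ge[OF fin(1)] by (metis imageE imageI)
      have "v \<noteq> r0"
      proof
        assume "v = r0"
        then have "pverts T \<subseteq> {r0}"
          using v R.dep_branch[of _ r0] R.branch_root by fastforce
        then have "card (pverts T) \<le> 1" using card_mono[of "{r0}"] by auto
        then show False using n by simp
      qed
      moreover have "R.children v = {}"
        using v(2) R.dep_par by (fastforce simp: R.children_def)
      ultimately have "?N v = {par v}"
        unfolding arcs using v(1) by (auto simp: R.up_iff R.children_def)
      then show ?thesis using that v by simp
    qed
    obtain par dep where rt: "rooted_tree (pverts T) r par dep" and
      arcs: "parcs T = rooted_tree.up (pverts T) r par \<union> (rooted_tree.up (pverts T) r par)\<inverse>"
      using tree_is_rooted_tree[OF assms(1) r(1)] by blast
    interpret R: rooted_tree "pverts T" r par dep by fact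
    have "?N r = R.children r" unfolding arcs by (auto simp: R.up_iff R.children_def)
    with r have one: "card (R.children r) = 1" by simp
    have "card (R.children v) \<le> 1" if v: "v \<in> pverts T" "v \<noteq> r" for v
    proof -
      have "?N v = insert (par v) (R.children v)"
        unfolding arcs using v by (auto simp: R.up_iff R.children_def)
      moreover have "par v \<notin> R.children v"
        using R.dep_par[of v] R.dep_par[of "par v"] v by (auto simp: R.children_def)
      ultimately show ?thesis using deg[of v] v R.finite_children by simp
    qed
    then have "\<exists>c. R.full c" using R.full_path[OF one _ n] by blast
    then show ?thesis using isolating_if_full[OF pg rt arcs] by blast
  qed
qed

end
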